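(* Let $a_1,\dots,a_k$ be integers ($k\ge3$) such that the equation $\sum_{i=1}^k a_ix_i=0$ is graph-regular. Then there is a nonempty set $I\subsetneq[k]$ such that $\sum_{i\in I}a_i=\sum_{j\notin I}a_j=0$.
   Context: Write $[N]=\{1,\dots,N\}$. For an integer matrix $A$ (here a single row $(a_1,\dots,a_k)$) with $k\ge 3$ columns, the equation $A\mathbf{x}=\mathbf{0}$ is called graph-regular if there is a function $N_A(r)$ such that for every $r\in\mathbb{N}$ and every $N>N_A(r)$, every $r$-coloring of the edges of the complete graph on vertex set $[N]$ admits a vector $\mathbf{x}=(x(1),\dots,x(k))\in[N]^k$ with $A\mathbf{x}=\mathbf{0}$ such that the values $x(1),\dots,x(k)$ are pairwise distinct and all edges $\{x(i),x(j)\}$ ($i\ne j$) have the same color. *)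

theory Defs
  imports "HOL-Analysis.Analysis" "HOL-Library.Ramsey"
begin

text \<open>
  The set \<open>[N]\<close> is rendered as \<^term>\<open>{1..int N}\<close>, so that vertices, coefficients and solutions are
  all integers. The edges of the complete graph on \<open>[N]\<close> are its 2-element subsets
  \<^term>\<open>[{1..int N}]\<^bsup>2\<^esup>\<close>, and an \<open>r\<close>-coloring is a map from them to \<^term>\<open>{1..r}\<close> that need not be
  surjective. The columns of \<open>A\<close> are indexed by the finite type \<^typ>\<open>'k\<close>.
\<close>

definition graph_regular :: "int ^ 'k ^ 'm \<Rightarrow> bool" where
  "graph_regular A \<longleftrightarrow>
    (\<exists>N\<^sub>A :: nat \<Rightarrow> nat. \<forall>r N. N > N\<^sub>A r \<longrightarrow>
      (\<forall>c \<in> [{1..int N}]\<^bsup>2\<^esup> \<rightarrow> {1..r}.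
        \<exists>x :: int ^ 'k.
          (\<forall>i. x $ i \<in> {1..int N}) \<and>
          A *v x = 0 \<and>
          (\<forall>i j. i \<noteq> j \<longrightarrow> x $ i \<noteq> x $ j) \<and>
          (\<exists>t. \<forall>i j. i \<noteq> j \<longrightarrow> c {x $ i, x $ j} = t)))"

end

theory Submission
  imports Defs "HOL-Computational_Algebra.Primes"
begin

text \<open>
  Fix a prime \<open>p > \<Sum>\<bar>a\<^sub>i\<bar>\<close>. As in Rado's argument, if the nonzero \<open>y\<^sub>i\<close> share their lowest nonzero
  base-\<open>p\<close> digit and \<open>\<Sum> a\<^sub>i y\<^sub>i = 0\<close>, then the coefficients of the \<open>y\<^sub>i\<close> of least \<open>p\<close>-adic valuation
  sum to zero. Colour an edge \<open>u < v\<close> by the lowest digits of \<open>v - u\<close>, \<open>u\<close> and \<open>v\<close>, and by whether \<open>u\<close>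
  and \<open>v\<close> have the same valuation. In a monochromatic solution the \<open>x\<^sub>i\<close> share their lowest digit
  (as \<open>k \<ge> 3\<close>), and their valuations are all equal or pairwise distinct. Distinct valuations would
  single out one nonzero coefficient that is zero, so they are equal and \<open>\<Sum> a\<^sub>i = 0\<close>. Hence
  the differences \<open>x\<^sub>i - x\<^sub>m\<close> from the smallest entry \<open>x\<^sub>m\<close> solve the equation too, and the
  indices where their valuation is least form \<open>I\<close>, which misses \<open>m\<close>.
\<close>

text \<open>At \<open>n = 0\<close> the multiplicity is 0 by convention and the digit is 0, so zero
  entries have to be excluded wherever digits or valuations are compared.\<close>

definition lowest_digit :: "int \<Rightarrow> int \<Rightarrow> int" where
  "lowest_digit p n = n div p ^ multiplicity p n mod p"

lemma lowest_digit_range: "prime p \<Longrightarrow> lowest_digit p n \<in> {0..<p}"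
  by (simp add: lowest_digit_def prime_gt_0_int)

lemma not_dvd_lowest_digit:
  assumes "prime p" "n \<noteq> 0"
  shows "\<not> p dvd lowest_digit p n"
proof -
  have "\<not> p dvd n div p ^ multiplicity p n"
    using assms by (intro multiplicity_decompose) auto
  then show ?thesis
    by (simp add: lowest_digit_def dvd_mod_iff)
qed

lemma lowest_digit_cong:
  "p ^ Suc (multiplicity p n) dvd n - lowest_digit p n * p ^ multiplicity p n"
proof -
  let ?q = "p ^ multiplicity p n"
  have "n = ?q * (n div ?q)"
    by (simp add: multiplicity_dvd)
  moreover have "n div ?q = p * (n div ?q div p) + lowest_digit p n"
    by (simp add: lowest_digit_def)
  ultimately have "n = ?q * (p * (n div ?q div p) + lowest_digit p n)"
    by metis
  then have "n - lowest_digit p n * ?q = p ^ Suc (multiplicity p n) * (n div ?q div p)"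
    by (simp add: algebra_simps)
  then show ?thesis
    by (metis dvd_triv_left)
qed

text \<open>Modulo \<open>p ^ Suc m\<close> only the terms of valuation exactly \<open>m\<close>
  survive, and each contributes \<open>a i * D * p ^ m\<close>. Cancelling \<open>p ^ m\<close> and
  then \<open>D\<close> leaves the claim. If no term attains \<open>m\<close>, the sum is
  empty.\<close>

lemma prime_dvd_sum_least_valuation:
  fixes a y :: "'k \<Rightarrow> int"
  assumes "finite J" "prime p" and zero: "(\<Sum>i\<in>J. a i * y i) = 0"
    and digit: "\<And>i. i \<in> J \<Longrightarrow> y i \<noteq> 0 \<Longrightarrow> lowest_digit p (y i) = D"
    and least: "\<And>i. i \<in> J \<Longrightarrow> y i \<noteq> 0 \<Longrightarrow> m \<le> multiplicity p (y i)"
  shows "p dvd (\<Sum>i | i \<in> J \<and> y i \<noteq> 0 \<and> multiplicity p (y i) = m. a i)"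
proof (cases "\<exists>i\<in>J. y i \<noteq> 0 \<and> multiplicity p (y i) = m")
  case True
  let ?P = "\<lambda>i. y i \<noteq> 0 \<and> multiplicity p (y i) = m"
  have "p ^ Suc m dvd a i * y i - (if ?P i then a i * (D * p ^ m) else 0)" if i: "i \<in> J" for i
  proof (cases "?P i")
    case True
    then have "p ^ Suc m dvd y i - D * p ^ m"
      using lowest_digit_cong[of p "y i"] digit[OF i] by auto
    then have "p ^ Suc m dvd a i * (y i - D * p ^ m)"
      by (rule dvd_mult)
    with True show ?thesis
      by (simp only: right_diff_distrib if_True simp_thms)
  next
    case False
    have "p ^ Suc m dvd y i"
    proof (cases "y i = 0")
      case nz: False
      then have "Suc m \<le> multiplicity p (y i)"
        using least[OF i] False by fastforce
      then show ?thesis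
        by (rule multiplicity_dvd')
    qed simp
    with False show ?thesis
      by (simp only: if_False diff_zero dvd_mult)
  qed
  then have "p ^ Suc m dvd (\<Sum>i\<in>J. a i * y i - (if ?P i then a i * (D * p ^ m) else 0))"
    by (rule dvd_sum)
  also have "\<dots> = - (\<Sum>i\<in>{i \<in> J. ?P i}. a i * (D * p ^ m))"
    using \<open>finite J\<close> zero by (simp only: sum_subtractf sum.inter_filter[symmetric])
  also have "\<dots> = - ((\<Sum>i\<in>{i \<in> J. ?P i}. a i) * D * p ^ m)"
    by (simp add: sum_distrib_right mult.assoc)
  finally have "p * p ^ m dvd ((\<Sum>i\<in>{i \<in> J. ?P i}. a i) * D) * p ^ m"
    by simp
  then have "p dvd (\<Sum>i\<in>{i \<in> J. ?P i}. a i) * D"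
    using \<open>prime p\<close> by (auto simp: dvd_mult_cancel_right)
  \<comment> \<open>In this case some nonzero \<open>y i\<close> exists, and \<open>D\<close> is its
    lowest digit.\<close>
  moreover have "\<not> p dvd D"
    using True digit not_dvd_lowest_digit[OF \<open>prime p\<close>] by metis
  ultimately show ?thesis
    using \<open>prime p\<close> by (auto simp: prime_dvd_mult_iff)
next
  case False
  then have "{i \<in> J. y i \<noteq> 0 \<and> multiplicity p (y i) = m} = {}"
    by blast
  then show ?thesis
    by (metis dvd_0_right sum.empty)
qed

text \<open>Graph-regularity restated for colours in any finite set that may depend on the order of
  the endpoints: \<open>Min\<close> and \<open>Max\<close> recover the order from an edge, and a
  bijection numbers the colours.\<close>

lemma graph_regular_finite_colouring:
  fixes A :: "int ^ 'k ^ 'm"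
  assumes "graph_regular A" "finite K"
    and col: "\<And>u v. 0 < u \<Longrightarrow> u < v \<Longrightarrow> col u v \<in> K"
  obtains x t where "\<And>i. 0 < x $ i" "A *v x = 0" "inj (($) x)"
    "\<And>i j. x $ i < x $ j \<Longrightarrow> col (x $ i) (x $ j) = t"
proof -
  obtain h where h: "bij_betw h K {1..card K}"
    using ex_bij_betw_nat_finite_1[OF \<open>finite K\<close>] bij_betw_inv by blast
  define c where "c e = h (col (Min e) (Max e))" for e
  obtain N\<^sub>A :: "nat \<Rightarrow> nat" where "\<forall>r N. N > N\<^sub>A r \<longrightarrow> (\<forall>c \<in> [{1..int N}]\<^bsup>2\<^esup> \<rightarrow> {1..r}.
      \<exists>x :: int ^ 'k. (\<forall>i. x $ i \<in> {1..int N}) \<and> A *v x = 0 \<and>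
        (\<forall>i j. i \<noteq> j \<longrightarrow> x $ i \<noteq> x $ j) \<and> (\<exists>t. \<forall>i j. i \<noteq> j \<longrightarrow> c {x $ i, x $ j} = t))"
    using \<open>graph_regular A\<close> unfolding graph_regular_def ..
  note N\<^sub>A = this[rule_format, OF lessI, of _ "card K"]
  let ?N = "Suc (N\<^sub>A (card K))"
  have "c e \<in> {1..card K}" if e: "e \<in> [{1..int ?N}]\<^bsup>2\<^esup>" for e
  proof -
    obtain u v where uv: "e = {u, v}" "u < v" "u \<in> {1..int ?N}"
      using e by (auto simp: nsets_2_eq) (metis insert_commute linorder_neqE_linordered_idom)
    then have "Min e = u" "Max e = v"
      by auto
    then have "col (Min e) (Max e) \<in> K"
      using col uv by auto
    then show ?thesis
      unfolding c_def using h bij_betw_apply by metis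
  qed
  then have "c \<in> [{1..int ?N}]\<^bsup>2\<^esup> \<rightarrow> {1..card K}"
    by blast
  from N\<^sub>A[OF this] obtain x :: "int ^ 'k" and t where x: "\<forall>i. x $ i \<in> {1..int ?N}" "A *v x = 0"
      "\<forall>i j. i \<noteq> j \<longrightarrow> x $ i \<noteq> x $ j" "\<forall>i j. i \<noteq> j \<longrightarrow> c {x $ i, x $ j} = t"
    by (elim exE conjE) (rule that)
  show thesis
  proof (rule that)
    show pos: "0 < x $ i" for i
      using x(1)[rule_format, of i] by auto
    show "inj (($) x)"
      using x(3) by (auto intro: injI)
    show "col (x $ i) (x $ j) = inv_into K h t" if "x $ i < x $ j" for i j
    proof -
      have "t = h (col (x $ i) (x $ j))"
        using x(4)[rule_format, of i j] that by (auto simp: c_def)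
      then show ?thesis
        using h col[OF pos that] by (simp add: bij_betw_def)
    qed
  qed (fact x(2))
qed

theorem theorem3p2:
  fixes a :: "int ^ 'k"
  assumes "CARD('k) \<ge> 3"
    and "graph_regular (rowvector a :: int ^ 'k ^ 1)"
  shows "\<exists>I :: 'k set. I \<noteq> {} \<and> I \<subset> UNIV \<and>
           (\<Sum>i\<in>I. a $ i) = 0 \<and> (\<Sum>j\<in>UNIV - I. a $ j) = 0"
proof -
  obtain q :: nat where q: "prime q" "nat (\<Sum>i\<in>UNIV. \<bar>a $ i\<bar>) < q"
    using bigger_prime by blast
  define p where "p = int q"
  have p: "prime p" "(\<Sum>i\<in>UNIV. \<bar>a $ i\<bar>) < p"
    using q by (auto simp: p_def)
  \<comment> \<open>Every partial sum of coefficients is smaller than \<open>p\<close> in absolute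
    value, so divisibility by \<open>p\<close> forces it to vanish.\<close>
  have small: "(\<Sum>i\<in>I. a $ i) = 0" if "p dvd (\<Sum>i\<in>I. a $ i)" for I
  proof -
    have "\<bar>\<Sum>i\<in>I. a $ i\<bar> \<le> (\<Sum>i\<in>UNIV. \<bar>a $ i\<bar>)"
      by (rule order_trans[OF sum_abs sum_mono2]) auto
    then show ?thesis
      using that p(2) zdvd_imp_le[of p "\<bar>\<Sum>i\<in>I. a $ i\<bar>"] by fastforce
  qed
  let ?d = "lowest_digit p" and ?v = "multiplicity p"
  define col where "col u v = (?d (v - u), ?d u, ?d v, ?v u = ?v v)" for u v
  have "col u v \<in> {0..<p} \<times> {0..<p} \<times> {0..<p} \<times> UNIV" for u v
    using lowest_digit_range[OF p(1)] by (auto simp: col_def)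
  moreover have "finite ({0..<p} \<times> {0..<p} \<times> {0..<p} \<times> (UNIV :: bool set))"
    by simp
  ultimately obtain x t where pos: "\<And>i. 0 < x $ i" and sol: "rowvector a *v x = (0 :: int ^ 1)"
      and inj: "inj (($) x)" and mono: "\<And>i j. x $ i < x $ j \<Longrightarrow> col (x $ i) (x $ j) = t"
    using graph_regular_finite_colouring[OF assms(2)] by metis
  obtain D \<alpha> \<beta> e where "t = (D, \<alpha>, \<beta>, e)"
    by (cases t) auto
  with mono have lt: "?d (x $ j - x $ i) = D" "?d (x $ i) = \<alpha>" "?d (x $ j) = \<beta>"
      "(?v (x $ i) = ?v (x $ j)) = e" if "x $ i < x $ j" for i j
    using that by (auto simp: col_def)
  have eq: "(\<Sum>i\<in>UNIV. a $ i * x $ i) = 0"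
    using sol by (simp add: matrix_vector_mult_def rowvector_def vec_eq_iff)

  obtain m where m: "\<And>i. x $ m \<le> x $ i"
    using ex_min_if_finite[of "range (($) x)"] by (force simp: not_less)
  have m_less: "x $ m < x $ i" if "i \<noteq> m" for i
    using m[of i] inj that by (metis injD order_less_le)
  have third: "\<not> UNIV \<subseteq> {m, i}" for i
    using assms(1) card_mono[of "{m, i}" UNIV] by (auto simp: card_insert_if split: if_splits)
  obtain i where "i \<noteq> m"
    using third[of m] by auto
  moreover obtain j where "j \<noteq> m" "i \<noteq> j"
    using third[of i] by auto
  ultimately have ij: "i \<noteq> m" "j \<noteq> m" "i \<noteq> j"
    by simp_all
  then have "x $ i < x $ j \<or> x $ j < x $ i"
    using injD[OF inj, of i j] by linarith
  \<comment> \<open>The smaller of \<open>x $ i\<close> and \<open>x $ j\<close> is the lower end of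
    the edge between them and the upper end of its edge to \<open>x $ m\<close>, so its digit is
    both \<alpha> and \<beta>.\<close>
  then have "\<alpha> = \<beta>"
    using lt(2)[of i j] lt(2)[of j i] lt(3)[of m i] lt(3)[of m j] m_less ij by auto
  then have digit: "?d (x $ l) = \<alpha>" for l
    using lt(2)[of m i] lt(3)[of m l] m_less ij(1) by (cases "l = m") auto

  have total: "(\<Sum>i\<in>UNIV. a $ i) = 0"
  proof (cases e)
    case True
    define w where "w = ?v (x $ m)"
    have const: "?v (x $ l) = w" for l
      using lt(4)[of m l] m_less True by (cases "l = m") (auto simp: w_def)
    have "p dvd (\<Sum>i | i \<in> UNIV \<and> x $ i \<noteq> 0 \<and> ?v (x $ i) = w. a $ i)"
      by (rule prime_dvd_sum_least_valuation[where y = "($) x", OF finite p(1) eq digit])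
        (simp add: const)
    moreover have "{i. i \<in> UNIV \<and> x $ i \<noteq> 0 \<and> ?v (x $ i) = w} = UNIV"
      using pos by (auto simp: const less_le)
    ultimately show ?thesis
      using small[of UNIV] by simp
  next
    case False
    have inj_v: "i = j" if "?v (x $ i) = ?v (x $ j)" for i j
      using lt(4)[of i j] lt(4)[of j i] that False injD[OF inj, of i j] by linarith
    \<comment> \<open>Zero coefficients are dropped so that the single index of least valuation has
      a nonzero coefficient, which yields the contradiction.\<close>
    define J where "J = {i. a $ i \<noteq> 0}"
    show ?thesis
    proof (cases "J = {}")
      case False
      then obtain l where l: "l \<in> J" "\<And>i. i \<in> J \<Longrightarrow> ?v (x $ l) \<le> ?v (x $ i)"
        using ex_has_least_nat[of "\<lambda>i. i \<in> J" _ "\<lambda>i. ?v (x $ i)"] by blast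
      have "(\<Sum>i\<in>J. a $ i * x $ i) = (\<Sum>i\<in>UNIV. a $ i * x $ i)"
        by (rule sum.mono_neutral_left) (auto simp: J_def)
      with eq have "(\<Sum>i\<in>J. a $ i * x $ i) = 0"
        by simp
      then have "p dvd (\<Sum>i | i \<in> J \<and> x $ i \<noteq> 0 \<and> ?v (x $ i) = ?v (x $ l). a $ i)"
        by (rule prime_dvd_sum_least_valuation[where y = "($) x", OF finite p(1) _ digit l(2)])
      moreover have "{i. i \<in> J \<and> x $ i \<noteq> 0 \<and> ?v (x $ i) = ?v (x $ l)} = {l}"
        using l(1) inj_v pos[of l] by auto
      ultimately have "a $ l = 0"
        using small[of "{l}"] by simp
      with l(1) show ?thesis
        by (simp add: J_def)
    qed (simp add: J_def)
  qed

  define y where "y i = x $ i - x $ m" for i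
  have y_nz: "y i \<noteq> 0 \<longleftrightarrow> i \<noteq> m" for i
    using m_less[of i] by (cases "i = m") (auto simp: y_def)
  obtain l where l: "l \<noteq> m" "\<And>i. i \<noteq> m \<Longrightarrow> ?v (y l) \<le> ?v (y i)"
    using ex_has_least_nat[of "\<lambda>i. i \<noteq> m" i "\<lambda>i. ?v (y i)"] ij(1) by blast
  define I where "I = {i. y i \<noteq> 0 \<and> ?v (y i) = ?v (y l)}"
  have eq_y: "(\<Sum>i\<in>UNIV. a $ i * y i) = 0"
    using eq total by (simp add: y_def right_diff_distrib sum_subtractf flip: sum_distrib_right)
  \<comment> \<open>Each nonzero \<open>y i\<close> is the length of the edge from
    \<open>x $ m\<close> to \<open>x $ i\<close>, whose digit is the first component of the
    colour.\<close>
  have digit_y: "?d (y i) = D" if "y i \<noteq> 0" for i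
    using lt(1) m_less that y_nz by (metis y_def)
  have "p dvd (\<Sum>i | i \<in> UNIV \<and> y i \<noteq> 0 \<and> ?v (y i) = ?v (y l). a $ i)"
    by (rule prime_dvd_sum_least_valuation[where y = y, OF finite p(1) eq_y digit_y]) (simp_all add: y_nz l(2))
  then have "(\<Sum>i\<in>I. a $ i) = 0"
    by (intro small) (simp add: I_def)
  moreover from this have "(\<Sum>i\<in>UNIV - I. a $ i) = 0"
    using total by (simp add: sum_diff)
  \<comment> \<open>The index \<open>l\<close> makes \<open>I\<close> nonempty; \<open>m\<close>
    makes it proper, since \<open>y m = 0\<close>.\<close>
  moreover have "l \<in> I" "m \<notin> I"
    using l(1) y_nz by (auto simp: I_def)
  ultimately show ?thesis
    by blast
qed

end
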